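(* Let $G$ be a Polish group, and let $\mathrm{Aut}(G)$ be the group of bicontinuous automorphisms of $G$. Suppose that $\mathcal{W}(G)$ is a countable basis for the topology of $G$ that is invariant under the natural action of $\mathrm{Aut}(G)$ on the open subsets of $G$, and that the range of the induced monomorphism $\mathrm{Aut}(G)\to\mathrm{Sym}(\mathcal{W}(G))$, $\Phi\mapsto(A\mapsto\Phi(A))$, is closed. Let $\tau$ be the topology on $\mathrm{Aut}(G)$ that makes this monomorphism a homeomorphism onto its range; thus, the subgroups of the form $\{\Phi\in\mathrm{Aut}(G): \Phi(A_i)=A_i \text{ for all } i=1,\dots,n\}$, where $A_1,\dots,A_n\in\mathcal{W}(G)$, form a neighbourhood basis of the identity consisting of open subgroups. Then $(\mathrm{Aut}(G),\tau)$ is a Polish group and the action $\mathrm{Aut}(G)\times G\to G$ is continuous.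
   Context: For a countable set $X$, $\mathrm{Sym}(X)$ is the group of permutations of $X$, which is a Polish group with the topology of pointwise convergence: the pointwise stabilisers of finite subsets of $X$ form a neighbourhood basis of the identity. *)

theory Defs
  imports "HOL-Analysis.Abstract_Metric_Spaces" "HOL-Analysis.Function_Topology" "HOL-Algebra.Bij"
begin

locale topological_group = group G for G :: "('a, 'm) monoid_scheme" (structure) +
  fixes T :: "'a topology"
  assumes topspace_eq: "topspace T = carrier G"
    and continuous_mult: "continuous_map (prod_topology T T) T (\<lambda>(x, y). x \<otimes> y)"
    and continuous_inv: "continuous_map T T (\<lambda>x. inv x)"

locale polish_group = topological_group +
  assumes separable: "separable_space T"
    and completely_metrizable: "completely_metrizable_space T"

definition topology_basis :: "'a topology \<Rightarrow> 'a set set \<Rightarrow> bool"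
  where "topology_basis T W \<longleftrightarrow> openin T = arbitrary union_of (\<lambda>A. A \<in> W)"

text \<open>Pointwise convergence on the permutation group \<open>BijGroup X\<close> of a discrete set \<open>X\<close>.
  Elements of \<open>Bij X\<close> are extensional, as are the points of a product topology.\<close>

definition sym_topology :: "'x set \<Rightarrow> ('x \<Rightarrow> 'x) topology"
  where "sym_topology X =
    subtopology (product_topology (\<lambda>_. discrete_topology X) X) (carrier (BijGroup X))"

definition cont_auto :: "('a, 'm) monoid_scheme \<Rightarrow> 'a topology \<Rightarrow> ('a \<Rightarrow> 'a) set"
  where "cont_auto G T = {\<Phi> \<in> auto G. homeomorphic_map T T \<Phi>}"

definition ContAutoGroup :: "('a, 'm) monoid_scheme \<Rightarrow> 'a topology \<Rightarrow> ('a \<Rightarrow> 'a) monoid"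
  where "ContAutoGroup G T = AutoGroup G \<lparr>carrier := cont_auto G T\<rparr>"

lemma carrier_ContAutoGroup [simp]: "carrier (ContAutoGroup G T) = cont_auto G T"
  by (simp add: ContAutoGroup_def)

definition induced_perm :: "'a set set \<Rightarrow> ('a \<Rightarrow> 'a) \<Rightarrow> 'a set \<Rightarrow> 'a set"
  where "induced_perm W \<Phi> = (\<lambda>A\<in>W. \<Phi> ` A)"

definition transported_topology ::
    "('a, 'm) monoid_scheme \<Rightarrow> 'a topology \<Rightarrow> 'a set set \<Rightarrow> ('a \<Rightarrow> 'a) topology \<Rightarrow> bool"
  where "transported_topology G T W \<tau> \<longleftrightarrow>
    topspace \<tau> = cont_auto G T \<and>
    homeomorphic_map \<tau> (subtopology (sym_topology W) (induced_perm W ` cont_auto G T))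
      (induced_perm W)"

definition setwise_stabilizer ::
    "('a, 'm) monoid_scheme \<Rightarrow> 'a topology \<Rightarrow> 'a set set \<Rightarrow> ('a \<Rightarrow> 'a) set"
  where "setwise_stabilizer G T F = {\<Phi> \<in> cont_auto G T. \<forall>A\<in>F. \<Phi> ` A = A}"

end

theory Submission
  imports Defs "HOL-Analysis.Urysohn"
begin

text \<open>Since \<open>T\<close> is Hausdorff, an automorphism is determined by its action on \<open>W\<close>, so \<open>\<tau>\<close> is a
  copy of a closed subspace of the Polish space of permutations of \<open>W\<close>. Concretely, a set is
  \<open>\<tau>\<close>-open iff membership of each of its points \<open>\<Phi>\<close> is guaranteed by agreement with \<open>\<Phi>\<close> on
  finitely many \<open>A \<in> W\<close>. For continuity of the action at \<open>(\<Phi>, x)\<close>: if \<open>\<Phi> x \<in> B \<in> W\<close>, put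
  \<open>A = \<Phi>\<^sup>-\<^sup>1(B) \<in> W\<close>; every \<open>\<Psi>\<close> with \<open>\<Psi>(A) = \<Phi>(A)\<close> maps \<open>A\<close> into \<open>B\<close>.\<close>

section \<open>Pointwise convergence on sets of functions into a discrete set\<close>

text \<open>A basic open box restricts only finitely many coordinates, and in a discrete factor the
  restriction can be shrunk to a single value. So the members of \<open>S\<close> that agree with
  \<open>f\<close> on a finite set form a basic neighbourhood of \<open>f\<close>. Later openness
  arguments rest on this criterion.\<close>

lemma openin_subtopology_product_discrete:
  assumes S: "S \<subseteq> X \<rightarrow>\<^sub>E Y"
  shows "openin (subtopology (product_topology (\<lambda>_. discrete_topology Y) X) S) U \<longleftrightarrow>
    U \<subseteq> S \<and> (\<forall>f\<in>U. \<exists>F. finite F \<and> F \<subseteq> X \<and> (\<forall>g\<in>S. (\<forall>x\<in>F. g x = f x) \<longrightarrow> g \<in> U))"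
    (is "openin (subtopology ?P S) U \<longleftrightarrow> ?rhs")
proof
  assume "openin (subtopology ?P S) U"
  then obtain V where V: "openin ?P V" "U = V \<inter> S"
    by (auto simp: openin_subtopology)
  show ?rhs
  proof (intro conjI ballI)
    show "U \<subseteq> S" using V by auto
    fix f assume f: "f \<in> U"
    with V obtain B where B: "finite {x \<in> X. B x \<noteq> Y}" "\<And>x. x \<in> X \<Longrightarrow> B x \<subseteq> Y"
      "f \<in> Pi\<^sub>E X B" "Pi\<^sub>E X B \<subseteq> V"
      unfolding openin_product_topology_alt by fastforce
    \<comment> \<open>The restricted coordinates of the box serve as \<open>F\<close>: on them
      \<open>g\<close> takes the values of \<open>f\<close>, and elsewhere \<open>B x = Y\<close>
      imposes nothing new.\<close>
    have "g \<in> U" if g: "g \<in> S" "\<forall>x\<in>{x \<in> X. B x \<noteq> Y}. g x = f x" for g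
    proof -
      have gY: "g \<in> X \<rightarrow>\<^sub>E Y" using g S by blast
      have "g x \<in> B x" if "x \<in> X" for x
        using that g(2) B(3) gY by (cases "B x = Y") (auto simp: PiE_iff)
      with gY have "g \<in> Pi\<^sub>E X B" by (simp add: PiE_iff)
      with B(4) V(2) g show ?thesis by blast
    qed
    with B(1) show "\<exists>F. finite F \<and> F \<subseteq> X \<and> (\<forall>g\<in>S. (\<forall>x\<in>F. g x = f x) \<longrightarrow> g \<in> U)"
      by (intro exI[of _ "{x \<in> X. B x \<noteq> Y}"]) blast
  qed
next
  assume R: ?rhs
  show "openin (subtopology ?P S) U"
  proof (subst openin_subopen, intro ballI)
    fix f assume f: "f \<in> U"
    with R obtain F where F: "finite F" "F \<subseteq> X"
      "\<And>g. g \<in> S \<Longrightarrow> (\<forall>x\<in>F. g x = f x) \<Longrightarrow> g \<in> U"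
      by metis
    \<comment> \<open>The box of maps agreeing with \<open>f\<close> on \<open>F\<close>. Its
      factors are open by discreteness, and only those indexed by \<open>F\<close> can differ from
      \<open>Y\<close>.\<close>
    define B where "B = (\<lambda>x. if x \<in> F then {f x} else Y)"
    have fY: "f \<in> X \<rightarrow>\<^sub>E Y" using f R S by blast
    have BY: "B x \<subseteq> Y" if "x \<in> X" for x
      using fY that by (auto simp: B_def)
    have "finite {x \<in> X. B x \<noteq> Y}"
      by (rule finite_subset[OF _ F(1)]) (auto simp: B_def)
    with BY have "openin ?P (Pi\<^sub>E X B)"
      by (simp add: openin_PiE_gen)
    then have "openin (subtopology ?P S) (Pi\<^sub>E X B \<inter> S)"
      by (rule openin_subtopology_Int)
    moreover have "f \<in> Pi\<^sub>E X B \<inter> S"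
      using fY f R by (auto simp: B_def PiE_iff)
    moreover have "Pi\<^sub>E X B \<inter> S \<subseteq> U"
    proof
      fix g assume g: "g \<in> Pi\<^sub>E X B \<inter> S"
      have "g x = f x" if "x \<in> F" for x
      proof -
        have "g x \<in> B x" using g that F(2) by (auto simp: PiE_iff)
        with that show ?thesis by (simp add: B_def)
      qed
      with F(3) g show "g \<in> U" by blast
    qed
    ultimately show "\<exists>T. openin (subtopology ?P S) T \<and> f \<in> T \<and> T \<subseteq> U" by blast
  qed
qed

text \<open>Separability need not pass to arbitrary subspaces, so the dense set is built inside
  \<open>S\<close>: each finite subset of \<open>X \<times> Y\<close> that is part of the graph of a
  member of \<open>S\<close> selects one such member. There are countably many finite subsets, and
  every neighbourhood of \<open>f\<close> in \<open>S\<close> contains all members sharing some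
  finite part of the graph of \<open>f\<close>.\<close>

lemma separable_space_subtopology_product_discrete:
  assumes S: "S \<subseteq> X \<rightarrow>\<^sub>E Y" and X: "countable X" and Y: "countable Y"
  shows "separable_space (subtopology (product_topology (\<lambda>_. discrete_topology Y) X) S)"
    (is "separable_space ?P")
proof -
  define \<A> where "\<A> = {A. finite A \<and> A \<subseteq> X \<times> Y}"
  define c where "c = (\<lambda>A. SOME g. g \<in> S \<and> (\<forall>(x, y)\<in>A. g x = y))"
  \<comment> \<open>When no member of \<open>S\<close> extends \<open>A\<close>, the value
    \<open>c A\<close> is arbitrary; intersecting with \<open>S\<close> discards any value outside
    \<open>S\<close>.\<close>
  define C where "C = c ` \<A> \<inter> S"
  have top: "topspace ?P = S"
    using S by (auto simp: topspace_product_topology)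
  have "countable \<A>"
    unfolding \<A>_def using X Y by (intro countable_Collect_finite_subset) auto
  then have "countable C" unfolding C_def by auto
  moreover have "C \<subseteq> topspace ?P" unfolding top C_def by blast
  moreover have "?P closure_of C = topspace ?P"
  proof (rule equalityI[OF closure_of_subset_topspace], rule subsetI)
    fix f assume "f \<in> topspace ?P"
    then have f: "f \<in> S" unfolding top .
    show "f \<in> ?P closure_of C"
      unfolding in_closure_of
    proof (intro conjI allI impI)
      show "f \<in> topspace ?P" unfolding top by (rule f)
      fix U assume "f \<in> U \<and> openin ?P U"
      then obtain F where F: "finite F" "F \<subseteq> X"
          "\<And>g. g \<in> S \<Longrightarrow> (\<forall>x\<in>F. g x = f x) \<Longrightarrow> g \<in> U"
        unfolding openin_subtopology_product_discrete[OF S] by metis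
      let ?A = "(\<lambda>x. (x, f x)) ` F"
      have A: "?A \<in> \<A>"
        using F f S by (auto simp: \<A>_def)
      \<comment> \<open>\<open>f\<close> itself extends this part of its graph, so \<open>c\<close>
        makes a meaningful choice here.\<close>
      have "\<exists>g. g \<in> S \<and> (\<forall>(x, y)\<in>?A. g x = y)"
        using f by auto
      then have "c ?A \<in> S \<and> (\<forall>(x, y)\<in>?A. c ?A x = y)"
        unfolding c_def by (rule someI_ex)
      with A F(3)[of "c ?A"] have "c ?A \<in> C" "c ?A \<in> U"
        by (auto simp: C_def)
      then show "\<exists>y. y \<in> C \<and> y \<in> U" by blast
    qed
  qed
  ultimately show ?thesis unfolding separable_space_def by blast
qed

text \<open>The permutations form a \<open>G\<^sub>\<delta>\<close> set in the space of all self-maps: injectivity is a countable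
  conjunction of clopen conditions, and hitting a given point is an open condition.\<close>

lemma completely_metrizable_space_sym_topology:
  assumes "countable X"
  shows "completely_metrizable_space (sym_topology X)"
proof -
  let ?P = "product_topology (\<lambda>_. discrete_topology X) X"
  define D where "D = (\<lambda>(x, y). {f \<in> X \<rightarrow>\<^sub>E X. f x \<noteq> f y})"
  define E where "E = (\<lambda>y. {f \<in> X \<rightarrow>\<^sub>E X. y \<in> f ` X})"
  \<comment> \<open>Inserting the whole space keeps the family nonempty even when \<open>X\<close>
    is empty.\<close>
  define \<U> where "\<U> = insert (topspace ?P) (D ` {(x, y). x \<in> X \<and> y \<in> X \<and> x \<noteq> y} \<union> E ` X)"
  have P: "openin ?P U \<longleftrightarrow> U \<subseteq> X \<rightarrow>\<^sub>E X \<and>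
      (\<forall>f\<in>U. \<exists>F. finite F \<and> F \<subseteq> X \<and> (\<forall>g\<in>X \<rightarrow>\<^sub>E X. (\<forall>x\<in>F. g x = f x) \<longrightarrow> g \<in> U))" for U
    using openin_subtopology_product_discrete[of "X \<rightarrow>\<^sub>E X" X X U]
      subtopology_topspace[of ?P] by (simp add: topspace_product_topology)
  have cm: "completely_metrizable_space ?P"
    unfolding completely_metrizable_space_product_topology
    using assms countable_subset[of _ X] by (auto simp: completely_metrizable_space_discrete_topology)
  have openD: "openin ?P (D (x, y))" if "x \<in> X" "y \<in> X" for x y
    unfolding P
  proof (intro conjI ballI)
    show "D (x, y) \<subseteq> X \<rightarrow>\<^sub>E X" by (auto simp: D_def)
    fix f assume "f \<in> D (x, y)"
    then show "\<exists>F. finite F \<and> F \<subseteq> X \<and> (\<forall>g\<in>X \<rightarrow>\<^sub>E X. (\<forall>x\<in>F. g x = f x) \<longrightarrow> g \<in> D (x, y))"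
      using that by (intro exI[of _ "{x, y}"]) (auto simp: D_def)
  qed
  have openE: "openin ?P (E y)" if "y \<in> X" for y
    unfolding P
  proof (intro conjI ballI)
    show "E y \<subseteq> X \<rightarrow>\<^sub>E X" by (auto simp: E_def)
    fix f assume "f \<in> E y"
    \<comment> \<open>Agreement with \<open>f\<close> at one preimage \<open>x\<close> of
      \<open>y\<close> already forces \<open>y\<close> into the image.\<close>
    then obtain x where "x \<in> X" "f x = y" by (auto simp: E_def)
    then show "\<exists>F. finite F \<and> F \<subseteq> X \<and> (\<forall>g\<in>X \<rightarrow>\<^sub>E X. (\<forall>x\<in>F. g x = f x) \<longrightarrow> g \<in> E y)"
      by (intro exI[of _ "{x}"]) (auto simp: E_def intro!: rev_image_eqI[of x])
  qed
  have "countable {(x, y). x \<in> X \<and> y \<in> X \<and> x \<noteq> y}"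
    by (rule countable_subset[of _ "X \<times> X"]) (use assms in auto)
  then have "countable \<U>" unfolding \<U>_def using assms by auto
  moreover have "gdelta_in ?P U" if "U \<in> \<U>" for U
    using that openD openE unfolding \<U>_def
    by (auto intro!: open_imp_gdelta_in simp del: topspace_product_topology)
  ultimately have "gdelta_in ?P (\<Inter>\<U>)"
    by (intro gdelta_in_Inter) (auto simp: \<U>_def)
  moreover have "\<Inter>\<U> = carrier (BijGroup X)"
  proof (intro equalityI subsetI)
    fix f assume f: "f \<in> \<Inter>\<U>"
    then have fX: "f \<in> X \<rightarrow>\<^sub>E X" by (simp add: \<U>_def topspace_product_topology)
    have "f x \<noteq> f y" if "x \<in> X" "y \<in> X" "x \<noteq> y" for x y
    proof -
      have "f \<in> D (x, y)" using f that unfolding \<U>_def by blast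
      then show ?thesis by (simp add: D_def)
    qed
    then have "inj_on f X" by (auto simp: inj_on_def)
    moreover have "y \<in> f ` X" if "y \<in> X" for y
    proof -
      have "f \<in> E y" using f that unfolding \<U>_def by blast
      then show ?thesis by (simp add: E_def)
    qed
    ultimately show "f \<in> carrier (BijGroup X)"
      using fX by (auto simp: BijGroup_def Bij_def bij_betw_def PiE_iff)
  next
    fix f assume "f \<in> carrier (BijGroup X)"
    then have f: "f \<in> extensional X" "inj_on f X" "f ` X = X"
      by (auto simp: BijGroup_def Bij_def bij_betw_def)
    then show "f \<in> \<Inter>\<U>"
      by (auto simp: \<U>_def D_def E_def topspace_product_topology PiE_iff inj_on_def extensional_def)
  qed
  \<comment> \<open>The easy direction of Alexandrov's theorem: a \<open>G_delta\<close> subset of a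
    completely metrizable space is completely metrizable.\<close>
  ultimately show ?thesis
    unfolding sym_topology_def using completely_metrizable_space_gdelta_in[OF cm] by metis
qed

lemma carrier_BijGroup_subset: "carrier (BijGroup X) \<subseteq> X \<rightarrow>\<^sub>E X"
  by (auto simp: BijGroup_def Bij_def PiE_iff bij_betw_def extensional_def)

lemma topspace_sym_topology: "topspace (sym_topology X) = carrier (BijGroup X)"
  using carrier_BijGroup_subset[of X] by (auto simp: sym_topology_def topspace_product_topology)

text \<open>Lets the finite agreement criterion for function spaces be applied directly to subspaces
  of the permutation group.\<close>

lemma subtopology_sym_topology:
  assumes "S \<subseteq> carrier (BijGroup X)"
  shows "subtopology (sym_topology X) S =
    subtopology (product_topology (\<lambda>_. discrete_topology X) X) S"
  using assms by (simp add: sym_topology_def subtopology_subtopology Int_absorb1)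

section \<open>The group of bicontinuous automorphisms\<close>

lemma cont_autoD:
  assumes "\<Phi> \<in> cont_auto G T"
  shows "\<Phi> \<in> hom G G" "\<Phi> \<in> Bij (carrier G)" "homeomorphic_map T T \<Phi>"
    "inj_on \<Phi> (carrier G)" "\<Phi> ` carrier G = carrier G" "\<Phi> \<in> extensional (carrier G)"
  using assms by (auto simp: cont_auto_def auto_def Bij_def bij_betw_def)

lemma mult_ContAutoGroup:
  assumes "\<Phi> \<in> cont_auto G T" "\<Psi> \<in> cont_auto G T"
  shows "\<Phi> \<otimes>\<^bsub>ContAutoGroup G T\<^esub> \<Psi> = compose (carrier G) \<Phi> \<Psi>"
  using assms by (simp add: ContAutoGroup_def AutoGroup_def BijGroup_def cont_autoD)

lemma one_ContAutoGroup: "\<one>\<^bsub>ContAutoGroup G T\<^esub> = (\<lambda>x\<in>carrier G. x)"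
  by (simp add: ContAutoGroup_def AutoGroup_def BijGroup_def)

context topological_group
begin

text \<open>Elements of the group are extensional, while identities, inverses and composites
  supplied by the topology library are unconstrained off the carrier. Since being a homeomorphism
  depends only on the values on \<open>topspace T\<close>, which is the carrier, one form can be
  exchanged for the other.\<close>

lemma subgroup_cont_auto: "subgroup (cont_auto G T) (AutoGroup G)"
proof -
  interpret A: group "AutoGroup G" by (rule AutoGroup)
  show ?thesis
  proof (rule A.subgroupI)
    show "cont_auto G T \<subseteq> carrier (AutoGroup G)"
      by (auto simp: cont_auto_def AutoGroup_def)
    have "homeomorphic_map T T (\<lambda>x\<in>carrier G. x)"
      by (rule homeomorphic_map_eq[of T T id]) (auto simp: topspace_eq)
    then have "(\<lambda>x\<in>carrier G. x) \<in> cont_auto G T"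
      using id_in_auto by (simp add: cont_auto_def)
    then show "cont_auto G T \<noteq> {}" by blast
  next
    fix \<Phi> assume \<Phi>: "\<Phi> \<in> cont_auto G T"
    then have a: "\<Phi> \<in> auto G" by (simp add: cont_auto_def)
    have "inv\<^bsub>AutoGroup G\<^esub> \<Phi> = inv\<^bsub>BijGroup (carrier G)\<^esub> \<Phi>"
      unfolding AutoGroup_def
      by (rule group.m_inv_consistent[OF group_BijGroup subgroup_auto a])
    also have "\<dots> = (\<lambda>x\<in>carrier G. inv_into (carrier G) \<Phi> x)"
      by (rule inv_BijGroup) (rule cont_autoD[OF \<Phi>])
    finally have eq: "inv\<^bsub>AutoGroup G\<^esub> \<Phi> = (\<lambda>x\<in>carrier G. inv_into (carrier G) \<Phi> x)" .
    obtain g where g: "homeomorphic_maps T T \<Phi> g"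
      using cont_autoD(3)[OF \<Phi>] by (auto simp: homeomorphic_map_maps)
    have "homeomorphic_map T T g"
      using g by (simp add: homeomorphic_maps_map)
    \<comment> \<open>The topological inverse \<open>g\<close> coincides on the carrier with the
      group inverse, so the latter inherits bicontinuity.\<close>
    moreover have "g x = (\<lambda>x\<in>carrier G. inv_into (carrier G) \<Phi> x) x" if "x \<in> topspace T" for x
    proof -
      have x: "x \<in> carrier G" using that by (simp add: topspace_eq)
      have "g x \<in> carrier G" "\<Phi> (g x) = x"
        using g that by (auto simp: homeomorphic_maps_def topspace_eq continuous_map_def Pi_iff)
      then have "inv_into (carrier G) \<Phi> x = g x"
        using inv_into_f_f[OF cont_autoD(4)[OF \<Phi>]] by metis
      with x show ?thesis by simp
    qed
    ultimately have "homeomorphic_map T T (inv\<^bsub>AutoGroup G\<^esub> \<Phi>)"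
      unfolding eq by (rule homeomorphic_map_eq)
    moreover have "inv\<^bsub>AutoGroup G\<^esub> \<Phi> \<in> auto G"
      using A.inv_closed[of \<Phi>] a by (simp add: AutoGroup_def)
    ultimately show "inv\<^bsub>AutoGroup G\<^esub> \<Phi> \<in> cont_auto G T"
      by (simp add: cont_auto_def)
  next
    fix \<Phi> \<Psi> assume \<Phi>: "\<Phi> \<in> cont_auto G T" and \<Psi>: "\<Psi> \<in> cont_auto G T"
    have eq: "\<Phi> \<otimes>\<^bsub>AutoGroup G\<^esub> \<Psi> = compose (carrier G) \<Phi> \<Psi>"
      using mult_ContAutoGroup[OF \<Phi> \<Psi>] by (simp add: ContAutoGroup_def)
    have "homeomorphic_map T T (\<Phi> \<circ> \<Psi>)"
      using \<Phi> \<Psi> by (blast intro: homeomorphic_map_compose cont_autoD)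
    then have "homeomorphic_map T T (\<Phi> \<otimes>\<^bsub>AutoGroup G\<^esub> \<Psi>)"
      unfolding eq by (rule homeomorphic_map_eq) (simp add: topspace_eq compose_def)
    moreover have "\<Phi> \<otimes>\<^bsub>AutoGroup G\<^esub> \<Psi> \<in> auto G"
      using A.m_closed[of \<Phi> \<Psi>] \<Phi> \<Psi> by (simp add: AutoGroup_def cont_auto_def)
    ultimately show "\<Phi> \<otimes>\<^bsub>AutoGroup G\<^esub> \<Psi> \<in> cont_auto G T"
      by (simp add: cont_auto_def)
  qed
qed

lemma group_ContAutoGroup: "group (ContAutoGroup G T)"
  unfolding ContAutoGroup_def by (rule subgroup.subgroup_is_group[OF subgroup_cont_auto AutoGroup])

end

sublocale topological_group \<subseteq> Aut: group "ContAutoGroup G T"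
  by (rule group_ContAutoGroup)

section \<open>Automorphisms permuting an invariant basis\<close>

locale invariant_basis = topological_group +
  fixes W
  assumes basis: "topology_basis T W"
    and invariant: "\<And>\<Phi> A. \<Phi> \<in> cont_auto G T \<Longrightarrow> A \<in> W \<Longrightarrow> \<Phi> ` A \<in> W"
begin

abbreviation "Aut \<equiv> ContAutoGroup G T"

lemma basis_open: "A \<in> W \<Longrightarrow> openin T A"
  using basis arbitrary_union_of_inc[of "\<lambda>A. A \<in> W" A] by (simp add: topology_basis_def)

lemma basis_subset: "A \<in> W \<Longrightarrow> A \<subseteq> carrier G"
  using basis_open openin_subset topspace_eq by metis

lemma basis_obtain:
  assumes "openin T U" "x \<in> U"
  obtains A where "A \<in> W" "x \<in> A" "A \<subseteq> U"
proof -
  have "(arbitrary union_of (\<lambda>A. A \<in> W)) U"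
    using assms basis by (simp add: topology_basis_def)
  then show ?thesis
    using assms(2) that unfolding arbitrary_union_of_alt by blast
qed

lemma image_mult:
  assumes "\<Phi> \<in> cont_auto G T" "\<Psi> \<in> cont_auto G T" "A \<subseteq> carrier G"
  shows "(\<Phi> \<otimes>\<^bsub>Aut\<^esub> \<Psi>) ` A = \<Phi> ` \<Psi> ` A"
proof -
  have "(\<Phi> \<otimes>\<^bsub>Aut\<^esub> \<Psi>) x = \<Phi> (\<Psi> x)" if "x \<in> A" for x
    using that assms by (auto simp: mult_ContAutoGroup compose_def)
  then show ?thesis by (simp add: image_image)
qed

lemma image_one: "A \<subseteq> carrier G \<Longrightarrow> \<one>\<^bsub>Aut\<^esub> ` A = A"
  by (auto simp: one_ContAutoGroup image_iff subset_iff)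

lemma inv_cont_auto: "\<Phi> \<in> cont_auto G T \<Longrightarrow> inv\<^bsub>Aut\<^esub> \<Phi> \<in> cont_auto G T"
  using Aut.inv_closed by simp

lemma image_inv:
  assumes "\<Phi> \<in> cont_auto G T" "A \<subseteq> carrier G"
  shows "(inv\<^bsub>Aut\<^esub> \<Phi>) ` \<Phi> ` A = A" "\<Phi> ` (inv\<^bsub>Aut\<^esub> \<Phi>) ` A = A"
  using assms image_mult[of "inv\<^bsub>Aut\<^esub> \<Phi>" \<Phi> A] image_mult[of \<Phi> "inv\<^bsub>Aut\<^esub> \<Phi>" A]
  by (simp_all add: inv_cont_auto image_one)

text \<open>Invariance gives only an inclusion, but it also applies to the inverse automorphism,
  whose action on \<open>W\<close> is a two-sided inverse.\<close>

lemma induced_perm_in_Bij: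
  assumes "\<Phi> \<in> cont_auto G T"
  shows "induced_perm W \<Phi> \<in> carrier (BijGroup W)"
proof -
  have "bij_betw (\<lambda>A\<in>W. \<Phi> ` A) W W"
    by (rule bij_betw_byWitness[where f' = "\<lambda>A. (inv\<^bsub>Aut\<^esub> \<Phi>) ` A"])
      (auto simp: assms invariant image_inv basis_subset inv_cont_auto)
  then show ?thesis by (simp add: BijGroup_def Bij_def induced_perm_def)
qed

lemma induced_perm_hom: "induced_perm W \<in> hom Aut (BijGroup W)"
proof (rule homI)
  fix \<Phi> assume "\<Phi> \<in> carrier Aut"
  then show "induced_perm W \<Phi> \<in> carrier (BijGroup W)" by (simp add: induced_perm_in_Bij)
next
  fix \<Phi> \<Psi> assume "\<Phi> \<in> carrier Aut" "\<Psi> \<in> carrier Aut"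
  then have *: "\<Phi> \<in> cont_auto G T" "\<Psi> \<in> cont_auto G T" by simp_all
  have "induced_perm W \<Phi> \<otimes>\<^bsub>BijGroup W\<^esub> induced_perm W \<Psi> =
      compose W (induced_perm W \<Phi>) (induced_perm W \<Psi>)"
    using *[THEN induced_perm_in_Bij] by (simp add: BijGroup_def)
  also have "\<dots> = induced_perm W (\<Phi> \<otimes>\<^bsub>Aut\<^esub> \<Psi>)"
    unfolding induced_perm_def compose_def
    by (rule restrict_ext) (simp add: * image_mult basis_subset invariant)
  finally show "induced_perm W (\<Phi> \<otimes>\<^bsub>Aut\<^esub> \<Psi>) =
      induced_perm W \<Phi> \<otimes>\<^bsub>BijGroup W\<^esub> induced_perm W \<Psi>" by simp
qed

text \<open>If \<Phi> and \<Psi> differ at \<open>x\<close>, some \<open>B\<close> in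
  \<open>W\<close> contains the first value and not the second. The preimage of \<open>B\<close>
  under \<Phi> is again in \<open>W\<close> and contains \<open>x\<close>; equal actions on
  \<open>W\<close> make \<Psi> map it onto \<open>B\<close>, a contradiction.\<close>

lemma induced_perm_inj:
  assumes "Hausdorff_space T"
  shows "inj_on (induced_perm W) (cont_auto G T)"
proof (rule inj_onI)
  fix \<Phi> \<Psi> assume \<Phi>: "\<Phi> \<in> cont_auto G T" and \<Psi>: "\<Psi> \<in> cont_auto G T"
    and eq: "induced_perm W \<Phi> = induced_perm W \<Psi>"
  have eqA: "\<Phi> ` A = \<Psi> ` A" if "A \<in> W" for A
    using fun_cong[OF eq, of A] that by (simp add: induced_perm_def)
  show "\<Phi> = \<Psi>"
  proof (rule extensionalityI[OF cont_autoD(6)[OF \<Phi>] cont_autoD(6)[OF \<Psi>]], rule ccontr)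
    fix x assume x: "x \<in> carrier G" and ne: "\<Phi> x \<noteq> \<Psi> x"
    have "\<Phi> x \<in> topspace T" "\<Psi> x \<in> topspace T"
      using x cont_autoD(5)[OF \<Phi>] cont_autoD(5)[OF \<Psi>] by (auto simp: topspace_eq)
    with ne assms obtain U V where "openin T U" "openin T V" "\<Phi> x \<in> U" "\<Psi> x \<in> V" "disjnt U V"
      unfolding Hausdorff_space_def by blast
    then obtain B where B: "B \<in> W" "\<Phi> x \<in> B" "\<Psi> x \<notin> B"
      by (metis basis_obtain disjnt_iff subsetD)
    let ?A = "(inv\<^bsub>Aut\<^esub> \<Phi>) ` B"
    have A: "?A \<in> W" "\<Phi> ` ?A = B"
      using B(1) \<Phi> by (simp_all add: invariant inv_cont_auto image_inv basis_subset)
    have "x \<in> ?A"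
      using B(2) A(2) basis_subset[OF A(1)] x cont_autoD(4)[OF \<Phi>]
      by (metis inj_on_image_mem_iff)
    then have "\<Psi> x \<in> \<Psi> ` ?A" by blast
    with B(3) A(2) eqA[OF A(1)] show False by simp
  qed
qed

lemma subgroup_setwise_stabilizer:
  assumes "F \<subseteq> W"
  shows "subgroup (setwise_stabilizer G T F) Aut"
proof (rule Aut.subgroupI)
  have F: "A \<subseteq> carrier G" if "A \<in> F" for A using that assms basis_subset by blast
  show "setwise_stabilizer G T F \<subseteq> carrier Aut" by (auto simp: setwise_stabilizer_def)
  have "\<one>\<^bsub>Aut\<^esub> \<in> setwise_stabilizer G T F"
    using Aut.one_closed F by (simp add: setwise_stabilizer_def image_one)
  then show "setwise_stabilizer G T F \<noteq> {}" by blast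
  fix \<Phi> assume \<Phi>: "\<Phi> \<in> setwise_stabilizer G T F"
  then have \<Phi>': "\<Phi> \<in> cont_auto G T" "\<And>A. A \<in> F \<Longrightarrow> \<Phi> ` A = A"
    by (auto simp: setwise_stabilizer_def)
  have "(inv\<^bsub>Aut\<^esub> \<Phi>) ` A = A" if "A \<in> F" for A
    using image_inv(1)[OF \<Phi>'(1) F[OF that]] \<Phi>'(2)[OF that] by simp
  then show "inv\<^bsub>Aut\<^esub> \<Phi> \<in> setwise_stabilizer G T F"
    using \<Phi>'(1) by (simp add: setwise_stabilizer_def inv_cont_auto)
  fix \<Psi> assume \<Psi>: "\<Psi> \<in> setwise_stabilizer G T F"
  then show "\<Phi> \<otimes>\<^bsub>Aut\<^esub> \<Psi> \<in> setwise_stabilizer G T F"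
    using \<Phi>' F Aut.m_closed[of \<Phi> \<Psi>] by (simp add: setwise_stabilizer_def image_mult)
qed

section \<open>The transported topology\<close>

abbreviation "aut_range \<equiv> induced_perm W ` cont_auto G T"

lemma ran_subset: "aut_range \<subseteq> carrier (BijGroup W)"
  using induced_perm_in_Bij by blast

text \<open>The finite agreement criterion on the range, read back through the homeomorphism: two
  induced permutations agree on \<open>F\<close> exactly when the automorphisms have equal images of
  every \<open>A\<close> in \<open>F\<close>.\<close>

lemma openin_transported:
  assumes "transported_topology G T W \<tau>"
  shows "openin \<tau> U \<longleftrightarrow> U \<subseteq> cont_auto G T \<and>
    (\<forall>\<Phi>\<in>U. \<exists>F. finite F \<and> F \<subseteq> W \<and>
      (\<forall>\<Psi>\<in>cont_auto G T. (\<forall>A\<in>F. \<Psi> ` A = \<Phi> ` A) \<longrightarrow> \<Psi> \<in> U))"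
proof (cases "U \<subseteq> cont_auto G T")
  case False
  then show ?thesis
    using assms openin_subset[of \<tau> U] by (auto simp: transported_topology_def)
next
  case True
  have top: "topspace \<tau> = cont_auto G T"
    and hom: "homeomorphic_map \<tau> (subtopology (sym_topology W) aut_range) (induced_perm W)"
    using assms by (auto simp: transported_topology_def)
  have inj: "inj_on (induced_perm W) (cont_auto G T)"
    using hom top by (simp add: homeomorphic_eq_everything_map)
  have agree: "(\<forall>A\<in>F. induced_perm W \<Psi> A = induced_perm W \<Phi> A) \<longleftrightarrow> (\<forall>A\<in>F. \<Psi> ` A = \<Phi> ` A)"
    if "F \<subseteq> W" for F \<Phi> \<Psi>
    using that by (intro ball_cong refl) (auto simp: induced_perm_def)
  \<comment> \<open>Injectivity, which is part of being a homeomorphism, ensures that passing to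
    images of sets loses no information.\<close>
  have mem: "induced_perm W \<Psi> \<in> induced_perm W ` U \<longleftrightarrow> \<Psi> \<in> U" if "\<Psi> \<in> cont_auto G T" for \<Psi>
    using inj_on_image_mem_iff[OF inj that True] .
  have "openin \<tau> U \<longleftrightarrow> openin (subtopology (sym_topology W) aut_range) (induced_perm W ` U)"
    using homeomorphic_map_openness[OF hom] True top by simp
  also have "\<dots> \<longleftrightarrow> (\<forall>\<Phi>\<in>U. \<exists>F. finite F \<and> F \<subseteq> W \<and>
      (\<forall>\<Psi>\<in>cont_auto G T. (\<forall>A\<in>F. \<Psi> ` A = \<Phi> ` A) \<longrightarrow> \<Psi> \<in> U))"
    unfolding subtopology_sym_topology[OF ran_subset]
      openin_subtopology_product_discrete[OF subset_trans[OF ran_subset carrier_BijGroup_subset]]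
    using True by (simp add: image_mono agree mem cong: conj_cong ball_cong)
  finally show ?thesis using True by simp
qed

text \<open>The pullback topology works because the map is injective on automorphisms when
  \<open>T\<close> is Hausdorff. Uniqueness holds because the criterion
  \<open>openin_transported\<close> describes the open sets without mentioning \<tau>.\<close>

lemma ex1_transported_topology:
  assumes "Hausdorff_space T"
  shows "\<exists>!\<tau>. transported_topology G T W \<tau>"
proof (rule ex_ex1I)
  let ?\<tau> = "pullback_topology (cont_auto G T) (induced_perm W) (sym_topology W)"
  let ?S = "subtopology (sym_topology W) aut_range"
  have top: "topspace ?\<tau> = cont_auto G T"
    using ran_subset by (auto simp: topspace_pullback_topology topspace_sym_topology)
  have topS: "topspace ?S = aut_range"
    using ran_subset by (auto simp: topspace_sym_topology)
  have "homeomorphic_map ?\<tau> ?S (induced_perm W)"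
  proof (rule bijective_open_imp_homeomorphic_map)
    show "continuous_map ?\<tau> ?S (induced_perm W)"
      unfolding continuous_map_in_subtopology
      using continuous_map_pullback[OF continuous_map_id, of "cont_auto G T" "induced_perm W"]
      by (simp add: top)
    show "open_map ?\<tau> ?S (induced_perm W)"
      unfolding open_map_def
    proof (intro allI impI)
      fix U assume "openin ?\<tau> U"
      then obtain V where V: "openin (sym_topology W) V" "U = induced_perm W -` V \<inter> cont_auto G T"
        by (auto simp: openin_pullback_topology)
      \<comment> \<open>Open sets of the pullback are preimages, so their images are traces of open
        sets on the range.\<close>
      then have "induced_perm W ` U = V \<inter> aut_range" by auto
      with V(1) show "openin ?S (induced_perm W ` U)" by (auto simp: openin_subtopology)
    qed
    show "induced_perm W ` topspace ?\<tau> = topspace ?S" unfolding top topS ..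
    show "inj_on (induced_perm W) (topspace ?\<tau>)"
      unfolding top by (rule induced_perm_inj[OF assms])
  qed
  with top show "\<exists>\<tau>. transported_topology G T W \<tau>" unfolding transported_topology_def by blast
next
  fix \<tau> \<tau>' assume "transported_topology G T W \<tau>" "transported_topology G T W \<tau>'"
  then show "\<tau> = \<tau>'" unfolding topology_eq by (simp add: openin_transported)
qed

lemma topspace_transported: "transported_topology G T W \<tau> \<Longrightarrow> topspace \<tau> = cont_auto G T"
  by (simp add: transported_topology_def)

section \<open>Stabilisers of finite subfamilies of the basis\<close>

lemma openin_transported_agree:
  assumes \<tau>: "transported_topology G T W \<tau>" and F: "finite F" "F \<subseteq> W"
  shows "openin \<tau> {\<Psi> \<in> cont_auto G T. \<forall>A\<in>F. \<Psi> ` A = \<Phi> ` A}"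
  unfolding openin_transported[OF \<tau>]
  by (intro conjI ballI exI[of _ F]) (use F in auto)

lemma openin_setwise_stabilizer:
  assumes \<tau>: "transported_topology G T W \<tau>" and F: "finite F" "F \<subseteq> W"
  shows "openin \<tau> (setwise_stabilizer G T F)"
proof -
  \<comment> \<open>The map \<open>id\<close> need not be extensional, hence need not be an
    automorphism in \<open>cont_auto G T\<close>; the agreement lemma accepts any reference
    map.\<close>
  have "setwise_stabilizer G T F = {\<Psi> \<in> cont_auto G T. \<forall>A\<in>F. \<Psi> ` A = id ` A}"
    by (simp add: setwise_stabilizer_def)
  with openin_transported_agree[OF assms, of id] show ?thesis by simp
qed

text \<open>This is the openness criterion at the identity: agreeing with the identity on
  \<open>F\<close> means fixing each member of \<open>F\<close> setwise.\<close>

lemma setwise_stabilizer_neighbourhood_basis: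
  assumes \<tau>: "transported_topology G T W \<tau>" and U: "openin \<tau> U" "\<one>\<^bsub>Aut\<^esub> \<in> U"
  shows "\<exists>F. finite F \<and> F \<subseteq> W \<and> setwise_stabilizer G T F \<subseteq> U"
proof -
  obtain F where F: "finite F" "F \<subseteq> W"
    "\<And>\<Psi>. \<Psi> \<in> cont_auto G T \<Longrightarrow> (\<forall>A\<in>F. \<Psi> ` A = \<one>\<^bsub>Aut\<^esub> ` A) \<Longrightarrow> \<Psi> \<in> U"
    using U unfolding openin_transported[OF \<tau>] by metis
  have one: "\<one>\<^bsub>Aut\<^esub> ` A = A" if "A \<in> F" for A
    using that F(2) by (intro image_one basis_subset) blast
  have "setwise_stabilizer G T F \<subseteq> U"
  proof
    fix \<Psi> assume "\<Psi> \<in> setwise_stabilizer G T F"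
    then show "\<Psi> \<in> U"
      by (intro F(3)) (simp_all add: setwise_stabilizer_def one)
  qed
  with F(1,2) show ?thesis by blast
qed

section \<open>Polish group structure\<close>

lemma topological_group_transported:
  assumes \<tau>: "transported_topology G T W \<tau>"
  shows "topological_group Aut \<tau>"
proof (intro topological_group.intro topological_group_axioms.intro)
  show "group Aut" by (rule group_ContAutoGroup)
  note top = topspace_transported[OF \<tau>]
  show "topspace \<tau> = carrier Aut" by (simp add: top)
  show "continuous_map (prod_topology \<tau> \<tau>) \<tau> (\<lambda>(\<Phi>, \<Psi>). \<Phi> \<otimes>\<^bsub>Aut\<^esub> \<Psi>)"
    unfolding continuous_map
  proof (intro conjI allI impI)
    show "(\<lambda>(\<Phi>, \<Psi>). \<Phi> \<otimes>\<^bsub>Aut\<^esub> \<Psi>) ` topspace (prod_topology \<tau> \<tau>) \<subseteq> topspace \<tau>"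
      using Aut.m_closed by (auto simp: top)
    fix U assume U: "openin \<tau> U"
    show "openin (prod_topology \<tau> \<tau>)
        {p \<in> topspace (prod_topology \<tau> \<tau>). (case p of (\<Phi>, \<Psi>) \<Rightarrow> \<Phi> \<otimes>\<^bsub>Aut\<^esub> \<Psi>) \<in> U}"
      (is "openin _ ?O")
      unfolding openin_prod_topology_alt
    proof (intro allI impI)
      fix \<Phi> \<Psi> assume "(\<Phi>, \<Psi>) \<in> ?O"
      then have *: "\<Phi> \<in> cont_auto G T" "\<Psi> \<in> cont_auto G T" "\<Phi> \<otimes>\<^bsub>Aut\<^esub> \<Psi> \<in> U"
        by (auto simp: top)
      then obtain F where F: "finite F" "F \<subseteq> W"
        "\<And>\<Theta>. \<Theta> \<in> cont_auto G T \<Longrightarrow> (\<forall>A\<in>F. \<Theta> ` A = (\<Phi> \<otimes>\<^bsub>Aut\<^esub> \<Psi>) ` A) \<Longrightarrow> \<Theta> \<in> U"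
        using U unfolding openin_transported[OF \<tau>] by metis
      \<comment> \<open>The left factor is tested on the sets that \<Psi> produces: if \<Psi>'
        agrees with \<Psi> on \<open>A\<close> and \<Phi>' with \<Phi> on the image of
        \<open>A\<close> under \<Psi>, then the two products agree on \<open>A\<close>.\<close>
      let ?F' = "(\<lambda>A. \<Psi> ` A) ` F"
      let ?V = "{\<Phi>' \<in> cont_auto G T. \<forall>A\<in>?F'. \<Phi>' ` A = \<Phi> ` A}"
      let ?V' = "{\<Psi>' \<in> cont_auto G T. \<forall>A\<in>F. \<Psi>' ` A = \<Psi> ` A}"
      have F': "finite ?F'" "?F' \<subseteq> W" using F *(2) invariant by auto
      have "?V \<times> ?V' \<subseteq> ?O"
      proof clarify
        fix \<Phi>' \<Psi>'
        assume a: "\<Phi>' \<in> cont_auto G T" "\<forall>A\<in>?F'. \<Phi>' ` A = \<Phi> ` A"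
          and b: "\<Psi>' \<in> cont_auto G T" "\<forall>A\<in>F. \<Psi>' ` A = \<Psi> ` A"
        have m: "\<Phi>' \<otimes>\<^bsub>Aut\<^esub> \<Psi>' \<in> cont_auto G T"
          using a(1) b(1) Aut.m_closed by simp
        have "(\<Phi>' \<otimes>\<^bsub>Aut\<^esub> \<Psi>') ` A = (\<Phi> \<otimes>\<^bsub>Aut\<^esub> \<Psi>) ` A" if "A \<in> F" for A
        proof -
          have A: "A \<subseteq> carrier G" using that F(2) basis_subset by blast
          show ?thesis using a b that A * by (simp add: image_mult)
        qed
        with F(3)[OF m] a(1) b(1)
        show "(\<Phi>', \<Psi>') \<in> topspace (prod_topology \<tau> \<tau>) \<and> \<Phi>' \<otimes>\<^bsub>Aut\<^esub> \<Psi>' \<in> U"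
          by (simp add: top)
      qed
      then show "\<exists>V V'. openin \<tau> V \<and> openin \<tau> V' \<and> \<Phi> \<in> V \<and> \<Psi> \<in> V' \<and> V \<times> V' \<subseteq> ?O"
        using openin_transported_agree[OF \<tau> F', of \<Phi>] openin_transported_agree[OF \<tau> F(1,2), of \<Psi>] *
        by (intro exI[of _ ?V] exI[of _ ?V'] conjI) simp_all
    qed
  qed
  show "continuous_map \<tau> \<tau> (\<lambda>\<Phi>. inv\<^bsub>Aut\<^esub> \<Phi>)"
    unfolding continuous_map
  proof (intro conjI allI impI)
    show "(\<lambda>\<Phi>. inv\<^bsub>Aut\<^esub> \<Phi>) ` topspace \<tau> \<subseteq> topspace \<tau>"
      by (auto simp: top inv_cont_auto)
    fix U assume U: "openin \<tau> U"
    show "openin \<tau> {\<Phi> \<in> topspace \<tau>. inv\<^bsub>Aut\<^esub> \<Phi> \<in> U}"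
      unfolding openin_transported[OF \<tau>]
    proof (intro conjI ballI)
      show "{\<Phi> \<in> topspace \<tau>. inv\<^bsub>Aut\<^esub> \<Phi> \<in> U} \<subseteq> cont_auto G T" by (auto simp: top)
      fix \<Phi> assume "\<Phi> \<in> {\<Phi> \<in> topspace \<tau>. inv\<^bsub>Aut\<^esub> \<Phi> \<in> U}"
      then have *: "\<Phi> \<in> cont_auto G T" "inv\<^bsub>Aut\<^esub> \<Phi> \<in> U" by (auto simp: top)
      then obtain F where F: "finite F" "F \<subseteq> W"
        "\<And>\<Theta>. \<Theta> \<in> cont_auto G T \<Longrightarrow> (\<forall>A\<in>F. \<Theta> ` A = (inv\<^bsub>Aut\<^esub> \<Phi>) ` A) \<Longrightarrow> \<Theta> \<in> U"
        using U unfolding openin_transported[OF \<tau>] by metis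
      \<comment> \<open>If \<Psi> agrees with \<Phi> on the preimage of \<open>A\<close> under
        \<Phi>, it maps that preimage onto \<open>A\<close>; hence the inverses of \<Psi> and \<Phi>
        agree on \<open>A\<close>.\<close>
      let ?F' = "(\<lambda>A. (inv\<^bsub>Aut\<^esub> \<Phi>) ` A) ` F"
      have "finite ?F'" "?F' \<subseteq> W" using F *(1) invariant inv_cont_auto by auto
      moreover have "inv\<^bsub>Aut\<^esub> \<Psi> \<in> U"
        if \<Psi>: "\<Psi> \<in> cont_auto G T" "\<forall>A\<in>?F'. \<Psi> ` A = \<Phi> ` A" for \<Psi>
      proof (rule F(3))
        show "inv\<^bsub>Aut\<^esub> \<Psi> \<in> cont_auto G T" using \<Psi>(1) by (rule inv_cont_auto)
        show "\<forall>A\<in>F. (inv\<^bsub>Aut\<^esub> \<Psi>) ` A = (inv\<^bsub>Aut\<^esub> \<Phi>) ` A"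
        proof
          fix A assume A: "A \<in> F"
          then have AW: "A \<in> W" using F(2) by blast
          let ?B = "(inv\<^bsub>Aut\<^esub> \<Phi>) ` A"
          have B: "?B \<in> W" using AW *(1) by (simp add: invariant inv_cont_auto)
          have "\<Psi> ` ?B = \<Phi> ` ?B" using \<Psi>(2) A by blast
          also have "\<dots> = A" using *(1) AW by (simp add: image_inv basis_subset)
          finally have "(inv\<^bsub>Aut\<^esub> \<Psi>) ` A = (inv\<^bsub>Aut\<^esub> \<Psi>) ` \<Psi> ` ?B" by simp
          also have "\<dots> = ?B" by (rule image_inv(1)[OF \<Psi>(1) basis_subset[OF B]])
          finally show "(inv\<^bsub>Aut\<^esub> \<Psi>) ` A = ?B" .
        qed
      qed
      ultimately show "\<exists>F. finite F \<and> F \<subseteq> W \<and> (\<forall>\<Psi>\<in>cont_auto G T. (\<forall>A\<in>F. \<Psi> ` A = \<Phi> ` A) \<longrightarrow>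
          \<Psi> \<in> {\<Phi> \<in> topspace \<tau>. inv\<^bsub>Aut\<^esub> \<Phi> \<in> U})"
        by (intro exI[of _ ?F']) (simp add: top)
    qed
  qed
qed

text \<open>Both properties are carried over from \<open>aut_range\<close> by the homeomorphism.
  Separability comes from countability of \<open>W\<close>; complete metrizability comes from being
  closed in the completely metrizable space of permutations of \<open>W\<close>.\<close>

lemma polish_group_transported:
  assumes \<tau>: "transported_topology G T W \<tau>" and W: "countable W"
    and closed: "closedin (sym_topology W) aut_range"
  shows "polish_group Aut \<tau>"
proof (intro polish_group.intro polish_group_axioms.intro)
  show "topological_group Aut \<tau>" by (rule topological_group_transported[OF \<tau>])
  have homeo: "\<tau> homeomorphic_space (subtopology (sym_topology W) aut_range)"
    using \<tau> homeomorphic_map_imp_homeomorphic_space unfolding transported_topology_def by blast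
  show "separable_space \<tau>"
    unfolding homeomorphic_separable_space[OF homeo] subtopology_sym_topology[OF ran_subset]
    using subset_trans[OF ran_subset carrier_BijGroup_subset] W W
    by (rule separable_space_subtopology_product_discrete)
  show "completely_metrizable_space \<tau>"
    unfolding homeomorphic_completely_metrizable_space[OF homeo]
    using completely_metrizable_space_sym_topology[OF W] closed
    by (rule completely_metrizable_space_closedin)
qed

section \<open>Joint continuity of the action\<close>

lemma continuous_action:
  assumes \<tau>: "transported_topology G T W \<tau>"
  shows "continuous_map (prod_topology \<tau> T) T (\<lambda>(\<Phi>, g). \<Phi> g)"
  unfolding continuous_map
proof (intro conjI allI impI)
  note top = topspace_transported[OF \<tau>]
  show "(\<lambda>(\<Phi>, g). \<Phi> g) ` topspace (prod_topology \<tau> T) \<subseteq> topspace T"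
  proof clarify
    fix \<Phi> g assume "(\<Phi>, g) \<in> topspace (prod_topology \<tau> T)"
    then show "\<Phi> g \<in> topspace T"
      using cont_autoD(5)[of \<Phi> G T] by (auto simp: top topspace_eq)
  qed
  fix U assume U: "openin T U"
  show "openin (prod_topology \<tau> T) {p \<in> topspace (prod_topology \<tau> T). (case p of (\<Phi>, g) \<Rightarrow> \<Phi> g) \<in> U}"
    (is "openin _ ?O")
    unfolding openin_prod_topology_alt
  proof (intro allI impI)
    fix \<Phi> x assume "(\<Phi>, x) \<in> ?O"
    then have *: "\<Phi> \<in> cont_auto G T" "x \<in> carrier G" "\<Phi> x \<in> U" by (auto simp: top topspace_eq)
    obtain B where B: "B \<in> W" "\<Phi> x \<in> B" "B \<subseteq> U" using basis_obtain[OF U *(3)] .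
    let ?A = "(inv\<^bsub>Aut\<^esub> \<Phi>) ` B"
    have A: "?A \<in> W" "\<Phi> ` ?A = B"
      using B(1) *(1) by (simp_all add: invariant inv_cont_auto image_inv basis_subset)
    have x: "x \<in> ?A"
      using B(2) A(2) basis_subset[OF A(1)] *(2) cont_autoD(4)[OF *(1)]
      by (metis inj_on_image_mem_iff)
    \<comment> \<open>A single test set suffices: every \<Psi> in \<open>?V\<close> maps all of
      \<open>?A\<close> onto \<open>B\<close>, which lies in \<open>U\<close>.\<close>
    let ?V = "{\<Psi> \<in> cont_auto G T. \<forall>C\<in>{?A}. \<Psi> ` C = \<Phi> ` C}"
    have "?V \<times> ?A \<subseteq> ?O"
    proof clarify
      \<comment> \<open>Points of \<open>?A\<close> appear here as preimages under \<Phi> of points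
        \<open>y\<close> of \<open>B\<close>, since \<open>?A\<close> is an image under the
        inverse.\<close>
      fix \<Psi> y
      assume \<Psi>: "\<Psi> \<in> cont_auto G T" "\<forall>C\<in>{?A}. \<Psi> ` C = \<Phi> ` C" and y: "y \<in> B"
      let ?z = "(inv\<^bsub>Aut\<^esub> \<Phi>) y"
      have z: "?z \<in> ?A" using y by blast
      then have "\<Psi> ?z \<in> \<Psi> ` ?A" by (rule imageI)
      also have "\<Psi> ` ?A = B" using \<Psi>(2) A(2) by simp
      finally show "(\<Psi>, ?z) \<in> topspace (prod_topology \<tau> T) \<and> \<Psi> ?z \<in> U"
        using B(3) z basis_subset[OF A(1)] \<Psi>(1) by (auto simp: top topspace_eq)
    qed
    moreover have "openin \<tau> ?V"
      using openin_transported_agree[OF \<tau>, of "{?A}" \<Phi>] A(1) by simp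
    ultimately show "\<exists>V A. openin \<tau> V \<and> openin T A \<and> \<Phi> \<in> V \<and> x \<in> A \<and> V \<times> A \<subseteq> ?O"
      using basis_open[OF A(1)] x *(1)
      by (intro exI[of _ ?V] exI[of _ ?A] conjI) simp_all
  qed
qed

end

text \<open>The topology \<tau> is characterised by a predicate rather than constructed. The unique
  existence clause therefore guarantees that the claims quantified over all such \<tau> concern one
  actual topology.\<close>

theorem mainTheorem5:
  fixes G :: "('a, 'm) monoid_scheme" and T :: "'a topology" and W :: "'a set set"
  assumes "polish_group G T"
    and "countable W"
    and "topology_basis T W"
    and "\<And>\<Phi> A. \<Phi> \<in> cont_auto G T \<Longrightarrow> A \<in> W \<Longrightarrow> \<Phi> ` A \<in> W"
    and "closedin (sym_topology W) (induced_perm W ` cont_auto G T)"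
  shows "induced_perm W \<in> mon (ContAutoGroup G T) (BijGroup W) \<and>
    (\<exists>!\<tau>. transported_topology G T W \<tau>) \<and>
    (\<forall>\<tau>. transported_topology G T W \<tau> \<longrightarrow>
      (\<forall>F. finite F \<and> F \<subseteq> W \<longrightarrow>
        subgroup (setwise_stabilizer G T F) (ContAutoGroup G T) \<and>
        openin \<tau> (setwise_stabilizer G T F)) \<and>
      (\<forall>U. openin \<tau> U \<and> \<one>\<^bsub>ContAutoGroup G T\<^esub> \<in> U \<longrightarrow>
        (\<exists>F. finite F \<and> F \<subseteq> W \<and> setwise_stabilizer G T F \<subseteq> U)) \<and>
      polish_group (ContAutoGroup G T) \<tau> \<and>
      continuous_map (prod_topology \<tau> T) T (\<lambda>(\<Phi>, g). \<Phi> g))"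
proof -
  interpret polish_group G T by (rule assms(1))
  interpret invariant_basis G T W
    by unfold_locales (fact assms(3), fact assms(4))
  \<comment> \<open>Metrizability of the Polish group supplies the separation of points needed for
    injectivity of \<open>induced_perm W\<close>.\<close>
  have H: "Hausdorff_space T"
    using completely_metrizable
    by (blast intro: completely_metrizable_imp_metrizable_space metrizable_imp_Hausdorff_space)
  show ?thesis
  proof (intro conjI allI impI)
    show "induced_perm W \<in> mon (ContAutoGroup G T) (BijGroup W)"
      using induced_perm_hom induced_perm_inj[OF H] by (simp add: mon_def)
    show "\<exists>!\<tau>. transported_topology G T W \<tau>"
      by (rule ex1_transported_topology[OF H])
    fix \<tau> assume \<tau>: "transported_topology G T W \<tau>"
    show "polish_group (ContAutoGroup G T) \<tau>"
      by (rule polish_group_transported[OF \<tau> assms(2,5)])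
    show "continuous_map (prod_topology \<tau> T) T (\<lambda>(\<Phi>, g). \<Phi> g)"
      by (rule continuous_action[OF \<tau>])
    show "subgroup (setwise_stabilizer G T F) (ContAutoGroup G T)" if "finite F \<and> F \<subseteq> W" for F
      using that by (simp add: subgroup_setwise_stabilizer)
    show "openin \<tau> (setwise_stabilizer G T F)" if "finite F \<and> F \<subseteq> W" for F
      using that by (simp add: openin_setwise_stabilizer[OF \<tau>])
    show "\<exists>F. finite F \<and> F \<subseteq> W \<and> setwise_stabilizer G T F \<subseteq> U"
      if "openin \<tau> U \<and> \<one>\<^bsub>ContAutoGroup G T\<^esub> \<in> U" for U
      using that setwise_stabilizer_neighbourhood_basis[OF \<tau>] by blast
  qed
qed

end
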